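(* Let $m>n\geq 0$ be integers and write $2m-2n=2^s r$ with $r$ odd. Then $$E_{2m}(q)\equiv q^{m-n}E_{2n}(q)\pmod{\prod_{k=0}^{s-1}\left(1+q^{2^{k}r}\right)}.$$
   Context: For $n\ge 1$ let $(a;q)_n=(1-a)(1-aq)\cdots(1-aq^{n-1})$, and $(a;q)_0=1$. The $q$-Euler numbers $E_{2n}(q)$ are defined by the formal power series identity $$\sum_{n=0}^{\infty}E_{2n}(q)\frac{x^{2n}}{(q;q)_{2n}}=\left(\sum_{n=0}^{\infty}\frac{x^{2n}}{(q;q)_{2n}}\right)^{-1}.$$ They are polynomials in $q$ with integer coefficients. Congruences between polynomials modulo a polynomial are understood in $\mathbb{Z}[q]$: $A(q)\equiv B(q)\pmod{C(q)}$ means that $C(q)$ divides $A(q)-B(q)$ in $\mathbb{Z}[q]$. *)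

theory Defs
  imports "HOL-Computational_Algebra.Computational_Algebra"
begin

definition q_pochhammer :: "'a::comm_ring_1 \<Rightarrow> 'a \<Rightarrow> nat \<Rightarrow> 'a" where
  "q_pochhammer a q n = (\<Prod>k<n. 1 - a * q ^ k)"

abbreviation q_var :: "int poly" where
  "q_var \<equiv> [:0, 1:]"

text \<open>
  The series \<open>\<Sum>n. a\<^sub>n x\<^sup>2\<^sup>n / (q;q)\<^sub>2\<^sub>n\<close>, with coefficients in the fraction field of
  \<open>\<int>[q]\<close>, so that the denominators make sense.
\<close>
definition q_even_series :: "(nat \<Rightarrow> int poly) \<Rightarrow> int poly fract fps" where
  "q_even_series a = Abs_fps (\<lambda>k. if even k
     then to_fract (a (k div 2)) / to_fract (q_pochhammer q_var q_var k) else 0)"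

text \<open>
  \<open>q_euler n\<close> is \<open>E\<^sub>2\<^sub>n(q)\<close>: the argument is half of the usual index. The defining identity
  has exactly one solution in \<open>\<int>[q]\<close>, see \<open>q_even_series_q_euler\<close> and \<open>q_euler_unique\<close> below.
\<close>
definition q_euler :: "nat \<Rightarrow> int poly" where
  "q_euler = (THE E. q_even_series E = inverse (q_even_series (\<lambda>_. 1)))"

lemma q_pochhammer_Suc: "q_pochhammer a q (Suc n) = q_pochhammer a q n * (1 - a * q ^ n)"
  by (simp add: q_pochhammer_def)

lemma q_pochhammer_mult_dvd:
  fixes q :: "'a::comm_ring_1"
  shows "q_pochhammer q q i * q_pochhammer q q j dvd q_pochhammer q q (i + j)"
proof (induction "i + j" arbitrary: i j)
  case 0
  then show ?case by (simp add: q_pochhammer_def)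
next
  case (Suc n)
  let ?P = "q_pochhammer q q"
  show ?case
  proof (cases "i = 0 \<or> j = 0")
    case True
    then show ?thesis by (auto simp: q_pochhammer_def)
  next
    case False
    then obtain a b where ab: "i = Suc a" "j = Suc b"
      by (metis not0_implies_Suc)
    have d1: "?P a * ?P j dvd ?P n" and d2: "?P i * ?P b dvd ?P n"
      using Suc.hyps(1)[of a j] Suc.hyps(1)[of i b] Suc.hyps(2) ab by auto
    have "?P i * ?P j = (?P a * ?P j) * (1 - q ^ i)"
      by (simp add: ab q_pochhammer_Suc mult_ac)
    with d1 have e1: "?P i * ?P j dvd ?P n * (1 - q ^ i)"
      by (metis mult_dvd_mono dvd_refl)
    have "?P i * ?P j = (?P i * ?P b) * (1 - q ^ j)"
      by (simp add: ab q_pochhammer_Suc mult_ac)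
    with d2 have "?P i * ?P j dvd ?P n * (1 - q ^ j)"
      by (metis mult_dvd_mono dvd_refl)
    then have e2: "?P i * ?P j dvd q ^ i * (?P n * (1 - q ^ j))"
      by (rule dvd_mult)
    have "?P (i + j) = ?P n * (1 - q ^ (i + j))"
      by (simp flip: Suc.hyps(2) add: q_pochhammer_Suc)
    also have "\<dots> = ?P n * (1 - q ^ i) + q ^ i * (?P n * (1 - q ^ j))"
      by (simp add: algebra_simps power_add)
    finally show ?thesis using e1 e2 by simp
  qed
qed

lemma q_pochhammer_q_var_nonzero: "q_pochhammer q_var q_var n \<noteq> 0"
proof
  assume "q_pochhammer q_var q_var n = 0"
  then have "poly (q_pochhammer q_var q_var n) 0 = 0" by simp
  then show False by (simp add: q_pochhammer_def poly_prod)
qed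

lemma inj_q_even_series:
  assumes "q_even_series a = q_even_series b"
  shows "a = b"
proof
  fix n
  have "fps_nth (q_even_series a) (2 * n) = fps_nth (q_even_series b) (2 * n)"
    using assms by simp
  then show "a n = b n"
    by (simp add: q_even_series_def q_pochhammer_q_var_nonzero)
qed

lemma ex_q_even_series_inverse: "\<exists>E. q_even_series E = inverse (q_even_series (\<lambda>_. 1))"
proof -
  let ?P = "q_pochhammer q_var q_var"
  define G where "G = q_even_series (\<lambda>_. 1)"
  define c where "c = fps_nth (inverse G)"
  have G: "fps_nth G k = (if even k then 1 / to_fract (?P k) else 0)" for k
    by (simp add: G_def q_even_series_def)
  have G0: "fps_nth G 0 = 1"
    by (simp add: G q_pochhammer_def)
  have "inverse G * G = 1"
    by (rule inverse_mult_eq_1) (simp add: G0)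
  then have sum0: "(\<Sum>i\<le>n. c i * fps_nth G (n - i)) = (if n = 0 then 1 else 0)" for n
    using fps_mult_nth[of "inverse G" G n] by (simp add: c_def atMost_atLeast0)
  have rec: "c n = - (\<Sum>i<n. c i * fps_nth G (n - i))" if "n > 0" for n
  proof -
    have "(\<Sum>i<n. c i * fps_nth G (n - i)) + c n = 0"
      using sum0[of n] that by (simp add: G0 flip: lessThan_Suc_atMost)
    then show ?thesis
      by (metis add.commute eq_neg_iff_add_eq_0)
  qed
  have c0: "c 0 = 1"
    using sum0[of 0] by (simp add: G0)
  have odd0: "c n = 0" if "odd n" for n
    using that
  proof (induction n rule: less_induct)
    case (less n)
    have "c i * fps_nth G (n - i) = 0" if "i < n" for i
      using less that by (cases "odd i") (auto simp: G)
    with less.prems show ?case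
      by (subst rec) (auto intro!: sum.neutral elim: oddE)
  qed
  have "\<exists>p. c n * to_fract (?P n) = to_fract p" for n
  proof (induction n rule: less_induct)
    case (less n)
    show ?case
    proof (cases "n = 0")
      case True
      then show ?thesis
        by (auto simp: c0)
    next
      case False
      have "\<exists>p. c i * fps_nth G (n - i) * to_fract (?P n) = to_fract p" if i: "i < n" for i
      proof (cases "even (n - i)")
        case True
        obtain p where p: "c i * to_fract (?P i) = to_fract p"
          using less[OF i] by blast
        obtain d where "?P n = ?P i * ?P (n - i) * d"
          using q_pochhammer_mult_dvd[of q_var i "n - i"] i by auto
        then have "c i * fps_nth G (n - i) * to_fract (?P n) = (c i * to_fract (?P i)) * to_fract d"
          using True by (simp add: G q_pochhammer_q_var_nonzero)
        then show ?thesis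
          by (metis p to_fract_mult)
      next
        case False
        then show ?thesis
          by (metis G mult_zero_left mult_zero_right to_fract_0)
      qed
      then obtain f where f: "\<And>i. i < n \<Longrightarrow> c i * fps_nth G (n - i) * to_fract (?P n) = to_fract (f i)"
        by metis
      have *: "to_fract (\<Sum>i<k. f i) = (\<Sum>i<k. to_fract (f i))" for k
        by (induction k) auto
      have "c n * to_fract (?P n) = - (\<Sum>i<n. c i * fps_nth G (n - i) * to_fract (?P n))"
        using False by (subst rec) (simp_all add: sum_distrib_right)
      also have "\<dots> = to_fract (- (\<Sum>i<n. f i))"
        by (simp add: f *)
      finally show ?thesis by blast
    qed
  qed
  then obtain p where p: "\<And>n. c n * to_fract (?P n) = to_fract (p n)"
    by metis
  have "q_even_series (\<lambda>n. p (2 * n)) = inverse G"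
  proof (rule fps_ext)
    fix k
    show "fps_nth (q_even_series (\<lambda>n. p (2 * n))) k = fps_nth (inverse G) k"
      using p[of k, symmetric] odd0[of k]
      by (auto simp: q_even_series_def q_pochhammer_q_var_nonzero simp flip: c_def)
  qed
  then show ?thesis
    by (auto simp: G_def)
qed

lemma q_even_series_q_euler: "q_even_series q_euler = inverse (q_even_series (\<lambda>_. 1))"
proof -
  obtain E where E: "q_even_series E = inverse (q_even_series (\<lambda>_. 1))"
    using ex_q_even_series_inverse by blast
  show ?thesis
    unfolding q_euler_def
    by (rule theI[where P = "\<lambda>E. q_even_series E = _", OF E]) (simp add: E inj_q_even_series)
qed

lemma q_euler_unique: "q_even_series E = inverse (q_even_series (\<lambda>_. 1)) \<Longrightarrow> E = q_euler"
  by (simp add: inj_q_even_series q_even_series_q_euler)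

end

theory Submission
  imports Defs
begin

text \<open>
  All roots of the monic modulus are simple, so it suffices to compare the two sides at each complex
  root \<open>\<zeta>\<close>. Such a \<open>\<zeta>\<close> is a primitive root of unity of even order \<open>2e\<close> with \<open>e\<close> dividing \<open>m - n\<close>, and
  \<open>\<zeta>\<^sup>e = -1\<close>. At \<open>\<zeta>\<close> the Gaussian binomials satisfy the Lucas-type rule
  \<open>[N + 2e, K] = [N, K] + [N, K - 2e]\<close>. Inserted in the recurrence \<open>\<Sum>k\<le>n. [2n, 2k] E\<^sub>2\<^sub>k = 0\<close> at index
  \<open>n + e\<close>, it shows that \<open>D\<^sub>k = E\<^sub>2\<^sub>k\<^sub>+\<^sub>2\<^sub>e + E\<^sub>2\<^sub>k\<close> satisfies \<open>\<Sum>k\<le>n. [2n, 2k] D\<^sub>k = 0\<close> for all \<open>n\<close>, hence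
  vanishes. Iterating, \<open>E\<^sub>2\<^sub>m(\<zeta>) = (-1)\<^bsup>(m-n)/e\<^esup> E\<^sub>2\<^sub>n(\<zeta>) = \<zeta>\<^bsup>m-n\<^esup> E\<^sub>2\<^sub>n(\<zeta>)\<close>.
\<close>

section \<open>Gaussian binomials, also at roots of unity\<close>

text \<open>The Pascal-type recursion needs no division, so it makes sense at roots of unity, where
  the usual quotient of \<open>q_pochhammer\<close> products can become 0/0.\<close>

fun q_binomial :: "'a::comm_ring_1 \<Rightarrow> nat \<Rightarrow> nat \<Rightarrow> 'a" where
  "q_binomial q n 0 = 1"
| "q_binomial q 0 (Suc k) = 0"
| "q_binomial q (Suc n) (Suc k) = q_binomial q n k + q ^ Suc k * q_binomial q n (Suc k)"

lemma q_binomial_eq_0: "n < k \<Longrightarrow> q_binomial q n k = 0"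
  by (induction q n k rule: q_binomial.induct) auto

lemma q_binomial_self [simp]: "q_binomial q n n = 1"
  by (induction n) (auto simp: q_binomial_eq_0)

text \<open>The identity \<open>1 - q^(i+j) = (1 - q^i) + q^i * (1 - q^j)\<close> mirrors the Pascal
  recursion. The form without quotients survives vanishing factors.\<close>

lemma q_binomial_mult_pochhammer:
  "q_binomial q (i + j) i * q_pochhammer q q i * q_pochhammer q q j = q_pochhammer q q (i + j)"
proof (induction "i + j" arbitrary: i j)
  case 0
  then show ?case by (simp add: q_pochhammer_def)
next
  case (Suc n)
  let ?P = "q_pochhammer q q"
  consider "i = 0" | "j = 0" | a b where "i = Suc a" "j = Suc b"
    by (metis not0_implies_Suc)
  then show ?case
  proof cases
    case 3
    have h: "q_binomial q n a * ?P a * ?P j = ?P n" "q_binomial q n i * ?P i * ?P b = ?P n"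
      using Suc.hyps(1)[of a j] Suc.hyps(1)[of i b] Suc.hyps(2) 3 by auto
    have "q_binomial q (i + j) i = q_binomial q n a + q ^ i * q_binomial q n i"
      unfolding Suc.hyps(2)[symmetric] unfolding 3(1) by (rule q_binomial.simps(3))
    then have "q_binomial q (i + j) i * ?P i * ?P j = (q_binomial q n a * ?P a * ?P j) * (1 - q ^ i)
      + q ^ i * (q_binomial q n i * ?P i * ?P b) * (1 - q ^ j)"
      by (simp add: 3 q_pochhammer_Suc algebra_simps)
    also have "\<dots> = ?P n * (1 - q ^ (i + j))"
      unfolding h by (simp add: algebra_simps power_add)
    also have "\<dots> = ?P (i + j)"
      by (simp flip: Suc.hyps(2) add: q_pochhammer_Suc)
    finally show ?thesis .
  qed (simp_all add: q_pochhammer_def)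
qed

text \<open>Row \<open>t\<close> has only its two outer entries, both 1. The weights
  \<open>q ^ Suc k\<close> of the recursion have period \<open>t\<close> in \<open>k\<close>, so the
  rule passes from each row to the next.\<close>

lemma q_binomial_add_order:
  fixes q :: "'a::idom"
  assumes "t > 0" and qt: "q ^ t = 1" and prim: "\<And>k. 0 < k \<Longrightarrow> k < t \<Longrightarrow> q ^ k \<noteq> 1"
  shows "q_binomial q (N + t) K = q_binomial q N K + (if t \<le> K then q_binomial q N (K - t) else 0)"
proof (induction N arbitrary: K)
  case 0
  consider "K = 0" | "K = t" | "K > t" | "0 < K" "K < t" by linarith
  then show ?case
  proof cases
    case 4
    \<comment> \<open>No factor vanishes below index \<open>t\<close>, while index \<open>t\<close>
      brings in \<open>1 - q ^ t = 0\<close>; hence the inner entries of row \<open>t\<close> are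
      0.\<close>
    have nz: "q_pochhammer q q k \<noteq> 0" if "k < t" for k
      using that prim by (auto simp: q_pochhammer_def simp flip: power_Suc)
    have "q_pochhammer q q t = 0"
      using \<open>t > 0\<close> qt by (auto simp: q_pochhammer_def simp flip: power_Suc intro!: bexI[of _ "t - 1"])
    then have "q_binomial q t K * q_pochhammer q q K * q_pochhammer q q (t - K) = 0"
      using q_binomial_mult_pochhammer[of q K "t - K"] 4 by simp
    with nz[of K] nz[of "t - K"] 4 show ?thesis
      by (simp add: q_binomial_eq_0)
  qed (use \<open>t > 0\<close> in \<open>auto simp: q_binomial_eq_0\<close>)
next
  case (Suc N)
  show ?case
  proof (cases K)
    case 0
    with \<open>t > 0\<close> show ?thesis by simp
  next
    case (Suc k)
    consider "Suc k < t" | "Suc k = t" | "t \<le> k" by linarith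
    then show ?thesis
    proof cases
      case 2
      \<comment> \<open>At \<open>K = t\<close> the extra summand comes from the second Pascal term
        alone, with weight \<open>q ^ t = 1\<close>.\<close>
      then have "q * q ^ k = 1" using qt by (metis power_Suc)
      moreover have "q_binomial q (N + t) k = q_binomial q N k"
        "q_binomial q (N + t) (Suc k) = q_binomial q N (Suc k) + 1"
        using 2 by (simp_all add: Suc.IH)
      ultimately have "q_binomial q (Suc N + t) (Suc k) = q_binomial q (Suc N) (Suc k) + 1"
        by (simp add: distrib_left)
      with 2 show ?thesis unfolding Suc by auto
    next
      case 3
      then obtain j where j: "k = t + j" by (auto simp: le_iff_add)
      have "q ^ k = q ^ j" by (simp add: j power_add qt)
      with 3 show ?thesis by (simp add: Suc Suc.IH j Suc_diff_le algebra_simps)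
    qed (simp add: Suc Suc.IH)
  qed
qed

section \<open>The recurrence of the q-Euler numbers and its antiperiodic solutions\<close>

text \<open>Compare coefficients of \<open>x^(2n)\<close> in the defining product, clear
  denominators with \<open>(q;q)_(2n)\<close>, and return to integer polynomials by injectivity of
  \<open>to_fract\<close>.\<close>

lemma q_euler_recurrence:
  "(\<Sum>k\<le>n. q_binomial q_var (2 * n) (2 * k) * q_euler k) = (if n = 0 then 1 else 0)"
proof -
  let ?P = "q_pochhammer q_var q_var"
  let ?E = "q_even_series q_euler" and ?G = "q_even_series (\<lambda>_. 1)"
  let ?f = "\<lambda>i. fps_nth ?E i * fps_nth ?G (2 * n - i)"
  have nz: "to_fract (?P k) \<noteq> 0" for k
    by (simp add: q_pochhammer_q_var_nonzero)
  have "?E * ?G = 1"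
    unfolding q_even_series_q_euler
    by (rule inverse_mult_eq_1) (simp add: q_even_series_def q_pochhammer_def)
  then have "(\<Sum>i\<le>2 * n. ?f i) = (if n = 0 then 1 else 0)"
    using fps_mult_nth[of ?E ?G "2 * n"] by (simp add: atMost_atLeast0)
  moreover have "(\<Sum>i\<le>2 * n. ?f i) = (\<Sum>k\<le>n. ?f (2 * k))"
  proof -
    have "(\<Sum>i\<le>2 * n. ?f i) = (\<Sum>i\<in>(\<lambda>k. 2 * k) ` {..n}. ?f i)"
      by (rule sum.mono_neutral_right) (auto simp: q_even_series_def elim!: evenE)
    also have "\<dots> = (\<Sum>k\<le>n. ?f (2 * k))"
      by (subst sum.reindex) (auto simp: inj_on_def)
    finally show ?thesis .
  qed
  moreover have step: "?f (2 * k) * to_fract (?P (2 * n))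
      = to_fract (q_binomial q_var (2 * n) (2 * k) * q_euler k)" if "k \<le> n" for k
  proof -
    have "?P (2 * n) = q_binomial q_var (2 * n) (2 * k) * ?P (2 * k) * ?P (2 * n - 2 * k)"
      using q_binomial_mult_pochhammer[of q_var "2 * k" "2 * n - 2 * k"] that by simp
    then have "to_fract (?P (2 * n))
        = to_fract (q_binomial q_var (2 * n) (2 * k)) * to_fract (?P (2 * k)) * to_fract (?P (2 * n - 2 * k))"
      by (metis to_fract_mult)
    then show ?thesis
      using nz[of "2 * k"] nz[of "2 * n - 2 * k"] that by (simp add: q_even_series_def)
  qed
  moreover have to_fract_sum: "to_fract (\<Sum>k\<le>j. g k) = (\<Sum>k\<le>j. to_fract (g k))"
    for g :: "nat \<Rightarrow> int poly" and j
    by (induction j) auto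
  moreover have "(\<Sum>k\<le>n. ?f (2 * k)) * to_fract (?P (2 * n))
      = to_fract (\<Sum>k\<le>n. q_binomial q_var (2 * n) (2 * k) * q_euler k)"
    unfolding to_fract_sum sum_distrib_right by (rule sum.cong) (simp_all only: step atMost_iff)
  ultimately have "to_fract (\<Sum>k\<le>n. q_binomial q_var (2 * n) (2 * k) * q_euler k)
      = (if n = 0 then 1 else 0) * to_fract (?P (2 * n))"
    by argo
  then have "to_fract (\<Sum>k\<le>n. q_binomial q_var (2 * n) (2 * k) * q_euler k)
      = to_fract (if n = 0 then 1 else 0)"
    by (simp add: q_pochhammer_def)
  then show ?thesis
    by (simp only: to_fract_eq_iff)
qed

text \<open>Only the recurrence matters, so \<open>f\<close> is kept arbitrary; it will be the
  sequence of values of \<open>q_euler\<close> at a root of unity.\<close>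

lemma q_euler_sequence_add:
  fixes q :: "'a::idom"
  assumes "e > 0" and qe: "q ^ (2 * e) = 1"
    and prim: "\<And>k. 0 < k \<Longrightarrow> k < 2 * e \<Longrightarrow> q ^ k \<noteq> 1"
    and rec: "\<And>n. (\<Sum>k\<le>n. q_binomial q (2 * n) (2 * k) * f k) = (if n = 0 then 1 else 0)"
  shows "f (k + e) = - f k"
proof -
  have sum0: "(\<Sum>k\<le>n. q_binomial q (2 * n) (2 * k) * (f (k + e) + f k)) = 0" for n
  proof -
    let ?b = "\<lambda>k. q_binomial q (2 * n) (2 * k)"
    \<comment> \<open>The order \<open>2 * e\<close> is even, so the shifted lower index
      \<open>2 * k - 2 * e\<close> stays even.\<close>
    have add_2e: "q_binomial q (2 * (n + e)) (2 * k)
        = ?b k + (if e \<le> k then ?b (k - e) else 0)" for k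
      using q_binomial_add_order[of "2 * e" q "2 * n" "2 * k"] \<open>e > 0\<close> qe prim
      by (simp add: algebra_simps diff_mult_distrib2)
    have "0 = (\<Sum>k\<le>n + e. q_binomial q (2 * (n + e)) (2 * k) * f k)"
      using rec[of "n + e"] \<open>e > 0\<close> by simp
    also have "\<dots> = (\<Sum>k\<le>n + e. ?b k * f k) + (\<Sum>k\<le>n + e. if e \<le> k then ?b (k - e) * f k else 0)"
      unfolding add_2e sum.distrib[symmetric] by (intro sum.cong) (auto simp: algebra_simps)
    also have "(\<Sum>k\<le>n + e. ?b k * f k) = (\<Sum>k\<le>n. ?b k * f k)"
      by (rule sum.mono_neutral_right) (auto simp: q_binomial_eq_0)
    also have "(\<Sum>k\<le>n + e. if e \<le> k then ?b (k - e) * f k else 0) = (\<Sum>k\<in>(\<lambda>k. k + e) ` {..n}. ?b (k - e) * f k)"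
    proof (rule sum.mono_neutral_cong_right)
      show "\<forall>k\<in>{..n + e} - (\<lambda>k. k + e) ` {..n}. (if e \<le> k then ?b (k - e) * f k else 0) = 0"
        by (auto simp: image_iff) (metis add_le_cancel_right atMost_iff le_add_diff_inverse2)
    qed auto
    also have "\<dots> = (\<Sum>k\<le>n. ?b k * f (k + e))"
      by (subst sum.reindex) auto
    finally show ?thesis
      by (simp add: algebra_simps sum.distrib)
  qed
  have "f (k + e) + f k = 0"
  proof (induction k rule: less_induct)
    case (less k)
    have "(\<Sum>i<k. q_binomial q (2 * k) (2 * i) * (f (i + e) + f i)) = 0"
      using less by (intro sum.neutral) auto
    \<comment> \<open>The system is triangular with diagonal entries
      \<open>q_binomial q (2 * k) (2 * k) = 1\<close>.\<close>
    then show ?case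
      using sum0[of k] by (simp flip: lessThan_Suc_atMost)
  qed
  then show ?thesis
    by (simp add: eq_neg_iff_add_eq_0)
qed

section \<open>Evaluation of integer polynomials\<close>

text \<open>This is the ring homomorphism sending \<open>q_var\<close> to \<open>z\<close>; it
  carries identities of integer polynomials over to complex roots of unity.\<close>

definition eval_int_poly :: "'a::{comm_ring_1,ring_char_0} \<Rightarrow> int poly \<Rightarrow> 'a" where
  "eval_int_poly z p = poly (map_poly of_int p) z"

lemma eval_int_poly_pCons [simp]: "eval_int_poly z (pCons a p) = of_int a + z * eval_int_poly z p"
  by (simp add: eval_int_poly_def map_poly_pCons)

lemma eval_int_poly_0 [simp]: "eval_int_poly z 0 = 0"
  by (simp add: eval_int_poly_def)

lemma eval_int_poly_1 [simp]: "eval_int_poly z 1 = 1"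
  by (simp add: eval_int_poly_def)

lemma eval_int_poly_add [simp]: "eval_int_poly z (p + q) = eval_int_poly z p + eval_int_poly z q"
proof -
  have "map_poly of_int (p + q) = map_poly of_int p + (map_poly of_int q :: 'a poly)"
    by (rule poly_eqI) (simp add: coeff_map_poly)
  then show ?thesis
    by (simp add: eval_int_poly_def)
qed

lemma eval_int_poly_smult [simp]: "eval_int_poly z (smult a p) = of_int a * eval_int_poly z p"
  by (simp add: eval_int_poly_def map_poly_smult)

lemma eval_int_poly_mult [simp]: "eval_int_poly z (p * q) = eval_int_poly z p * eval_int_poly z q"
  by (induction p) (simp_all add: algebra_simps)

lemma eval_int_poly_minus [simp]: "eval_int_poly z (- p) = - eval_int_poly z p"
  using eval_int_poly_smult[of z "-1" p] by simp

lemma eval_int_poly_diff [simp]: "eval_int_poly z (p - q) = eval_int_poly z p - eval_int_poly z q"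
  using eval_int_poly_add[of z p "- q"] by simp

lemma eval_int_poly_power [simp]: "eval_int_poly z (p ^ n) = eval_int_poly z p ^ n"
  by (induction n) simp_all

lemma eval_int_poly_sum [simp]: "eval_int_poly z (sum f A) = (\<Sum>x\<in>A. eval_int_poly z (f x))"
  by (induction A rule: infinite_finite_induct) simp_all

lemma eval_int_poly_q_binomial [simp]:
  "eval_int_poly z (q_binomial q_var n k) = q_binomial z n k"
  by (induction z n k rule: q_binomial.induct) simp_all

section \<open>Values of the q-Euler numbers at roots of unity\<close>

lemma eval_q_euler_add:
  fixes z :: "'a::{idom,ring_char_0}"
  assumes "e > 0" "z ^ (2 * e) = 1" "\<And>k. 0 < k \<Longrightarrow> k < 2 * e \<Longrightarrow> z ^ k \<noteq> 1"
  shows "eval_int_poly z (q_euler (k + e)) = - eval_int_poly z (q_euler k)"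
  using assms
proof (rule q_euler_sequence_add)
  show "(\<Sum>k\<le>n. q_binomial z (2 * n) (2 * k) * eval_int_poly z (q_euler k)) = (if n = 0 then 1 else 0)" for n
    using arg_cong[OF q_euler_recurrence[of n], of "eval_int_poly z"] by (simp split: if_splits)
qed

lemma eval_q_euler_congruence:
  fixes z :: "'a::{idom,ring_char_0}"
  assumes "n < m" and N: "2 * m - 2 * n = 2 ^ s * r" and "odd r"
    and z: "z ^ (2 ^ s * r) = 1" "z ^ r \<noteq> 1"
  shows "eval_int_poly z (q_euler m) = z ^ (m - n) * eval_int_poly z (q_euler n)"
proof -
  define t where "t = (LEAST t. t > 0 \<and> z ^ t = 1)"
  have pos: "2 ^ s * r > 0" using \<open>odd r\<close> by (simp add: odd_pos)
  have t: "t > 0 \<and> z ^ t = 1"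
    unfolding t_def by (rule LeastI[of _ "2 ^ s * r"]) (use pos z in simp)
  have prim: "z ^ k \<noteq> 1" if "0 < k" "k < t" for k
    using not_less_Least[of k "\<lambda>t. t > 0 \<and> z ^ t = 1"] that by (auto simp: t_def)
  have t_dvd: "t dvd k" if "z ^ k = 1" for k
  proof -
    have "z ^ k = (z ^ t) ^ (k div t) * z ^ (k mod t)"
      by (simp flip: power_mult power_add)
    with that t prim[of "k mod t"] show ?thesis
      by (auto simp: dvd_eq_mod_eq_0)
  qed
  \<comment> \<open>An odd order dividing \<open>2 ^ s * r\<close> would divide \<open>r\<close>,
    against \<open>z ^ r \<noteq> 1\<close>.\<close>
  have "even t"
  proof (rule ccontr)
    assume "odd t"
    moreover have "t dvd 2 ^ s * r" by (rule t_dvd) (rule z)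
    ultimately have "t dvd r"
      by (simp add: coprime_dvd_mult_right_iff)
    with t z(2) show False by (auto simp: power_mult)
  qed
  then obtain e where e: "t = 2 * e" by blast
  have "e > 0" using t e by simp
  have "z ^ e \<noteq> 1" using prim[of e] e \<open>e > 0\<close> by simp
  moreover have "(z ^ e)\<^sup>2 = 1" using t e by (simp flip: power_mult add: mult.commute)
  ultimately have ze: "z ^ e = -1" by (simp add: power2_eq_1_iff)
  have "2 * e dvd 2 * (m - n)"
    using t_dvd[OF z(1)] N by (simp add: e diff_mult_distrib2)
  then obtain j where j: "m - n = e * j" by auto
  have step: "eval_int_poly z (q_euler (k + e)) = - eval_int_poly z (q_euler k)" for k
    by (rule eval_q_euler_add) (use \<open>e > 0\<close> t e prim in auto)
  have "eval_int_poly z (q_euler (n + e * i)) = (-1) ^ i * eval_int_poly z (q_euler n)" for i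
  proof (induction i)
    case (Suc i)
    then show ?case using step[of "n + e * i"] by (simp add: algebra_simps)
  qed simp
  moreover have "m = n + e * j" using j \<open>n < m\<close> by linarith
  moreover have "z ^ (m - n) = (-1) ^ j" by (simp add: j power_mult ze)
  ultimately show ?thesis by simp
qed

section \<open>Divisibility by the modulus\<close>

text \<open>The remainder of \<open>p\<close> modulo \<open>g\<close> vanishes on \<open>S\<close>,
  which is too many roots for its degree unless it is 0.\<close>

lemma monic_dvd_if_eval_zero:
  fixes g p :: "int poly" and S :: "'a::{idom,ring_char_0} set"
  assumes monic: "lead_coeff g = 1" and card: "finite S" "degree g \<le> card S"
    and g0: "\<And>z. z \<in> S \<Longrightarrow> eval_int_poly z g = 0"
    and p0: "\<And>z. z \<in> S \<Longrightarrow> eval_int_poly z p = 0"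
  shows "g dvd p"
proof -
  have "g \<noteq> 0" using monic by auto
  \<comment> \<open>Leading coefficient 1 turns pseudo-division into ordinary division with
    remainder over the integers.\<close>
  obtain u v where uv: "pseudo_divmod p g = (u, v)" by fastforce
  have p: "p = g * u + v" and v: "v = 0 \<or> degree v < degree g"
    using pseudo_divmod[OF \<open>g \<noteq> 0\<close> uv] monic by simp_all
  have "v = 0"
  proof (rule ccontr)
    assume "v \<noteq> 0"
    let ?v = "map_poly of_int v :: 'a poly"
    have nz: "?v \<noteq> 0" using \<open>v \<noteq> 0\<close> by (simp add: map_poly_eq_0_iff)
    have "S \<subseteq> {z. poly ?v z = 0}"
      using g0 p0 by (auto simp: p simp flip: eval_int_poly_def)
    then have "card S \<le> card {z. poly ?v z = 0}"
      using nz by (intro card_mono poly_roots_finite)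
    also have "\<dots> \<le> degree ?v" using nz by (rule card_poly_roots_bound)
    also have "\<dots> \<le> degree v" by (rule map_poly_degree_leq)
    finally show False using v \<open>v \<noteq> 0\<close> card by simp
  qed
  with p show ?thesis by simp
qed

text \<open>Telescoping by \<open>(1 + y) * (y - 1) = y^2 - 1\<close>. The identity later yields the
  degree, leading coefficient and roots of the modulus.\<close>

lemma prod_1_plus_power_2:
  fixes x :: "'a::comm_ring_1"
  shows "(\<Prod>k<s. 1 + x ^ (2 ^ k * r)) * (x ^ r - 1) = x ^ (2 ^ s * r) - 1"
proof (induction s)
  case (Suc s)
  have "(\<Prod>k<Suc s. 1 + x ^ (2 ^ k * r)) * (x ^ r - 1)
      = (1 + x ^ (2 ^ s * r)) * (x ^ (2 ^ s * r) - 1)"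
    unfolding Suc.IH[symmetric] by (simp add: mult_ac)
  also have "\<dots> = x ^ (2 ^ Suc s * r) - 1"
  proof -
    have "2 ^ Suc s * r = 2 ^ s * r + 2 ^ s * r" by simp
    then show ?thesis by (simp only: power_add) (simp add: algebra_simps)
  qed
  finally show ?case .
qed simp

theorem corollary1p2:
  fixes m n s r :: nat
  assumes "n < m" and "2 * m - 2 * n = 2 ^ s * r" and "odd r"
  shows "(\<Prod>k<s. 1 + q_var ^ (2 ^ k * r)) dvd q_euler m - q_var ^ (m - n) * q_euler n"
proof -
  let ?g = "\<Prod>k<s. 1 + q_var ^ (2 ^ k * r)"
  \<comment> \<open>By the product identity these are roots of \<open>?g\<close>; their number
    \<open>2 ^ s * r - r\<close> equals its degree.\<close>
  define S where "S = {z::complex. z ^ (2 ^ s * r) = 1} - {z. z ^ r = 1}"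
  have "r > 0" using \<open>odd r\<close> by (rule odd_pos)
  have q_var_power: "q_var ^ k - 1 = monom 1 k - 1" for k
    by (simp add: monom_altdef)
  have deg: "degree (q_var ^ k - 1) = k" and lead: "lead_coeff (q_var ^ k - 1) = 1" if "k > 0" for k
  proof -
    have "degree (monom 1 k - 1 :: int poly) = k"
      using that degree_add_eq_left[of "-1" "monom 1 k :: int poly"] by (simp add: degree_monom_eq)
    then show "degree (q_var ^ k - 1) = k" "lead_coeff (q_var ^ k - 1) = 1"
      using that by (simp_all add: q_var_power)
  qed
  have prod: "?g * (q_var ^ r - 1) = q_var ^ (2 ^ s * r) - 1"
    by (rule prod_1_plus_power_2)
  show ?thesis
  proof (rule monic_dvd_if_eval_zero[where S = S])
    have "lead_coeff ?g * lead_coeff (q_var ^ r - 1) = lead_coeff (q_var ^ (2 ^ s * r) - 1)"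
      by (simp only: prod flip: lead_coeff_mult)
    then show "lead_coeff ?g = 1"
      using lead[of r] lead[of "2 ^ s * r"] \<open>r > 0\<close> by simp
    then have "?g \<noteq> 0" by (metis leading_coeff_0_iff zero_neq_one)
    moreover have "q_var ^ r - 1 \<noteq> 0" using deg[of r] \<open>r > 0\<close> by (metis degree_0 less_irrefl)
    ultimately have "degree ?g + degree (q_var ^ r - 1) = degree (q_var ^ (2 ^ s * r) - 1)"
      using degree_mult_eq[of ?g "q_var ^ r - 1", symmetric] unfolding prod by blast
    then have "degree ?g + r = 2 ^ s * r"
      using deg[of r] deg[of "2 ^ s * r"] \<open>r > 0\<close> by simp
    moreover have "card S = 2 ^ s * r - r"
    proof -
      have "{z::complex. z ^ r = 1} \<subseteq> {z. z ^ (2 ^ s * r) = 1}"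
        by (auto simp: power_mult mult.commute[of _ r])
      then show ?thesis
        unfolding S_def using \<open>r > 0\<close>
        by (subst card_Diff_subset) (auto simp: finite_roots_unity card_roots_unity_eq Suc_leI)
    qed
    ultimately show "degree ?g \<le> card S" by simp
    show "finite S"
      unfolding S_def using \<open>r > 0\<close> by (simp add: finite_roots_unity Suc_leI)
  next
    fix z assume "z \<in> S"
    then have z: "z ^ (2 ^ s * r) = 1" "z ^ r \<noteq> 1" by (auto simp: S_def)
    have "eval_int_poly z ?g * (z ^ r - 1) = z ^ (2 ^ s * r) - 1"
      using arg_cong[OF prod, of "eval_int_poly z"] by simp
    with z show "eval_int_poly z ?g = 0" by simp
    show "eval_int_poly z (q_euler m - q_var ^ (m - n) * q_euler n) = 0"
      using eval_q_euler_congruence[OF assms z] by simp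
  qed
qed

end
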